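(* Let $m\le n$ be natural numbers, let $G\in k[y_1,\dots,y_m]$, $H\in k[y_{m+1},\dots,y_n]$ and $F=G+H$. Denote by $\mathrm{Ann}(G)$ and $\mathrm{Ann}(H)$ the annihilators of $G$ and $H$ inside $k[[x_1,\dots,x_m]]$ and $k[[x_{m+1},\dots,x_n]]$ respectively, and by $\mathrm{Ann}(F)$ the annihilator of $F$ inside $S[n]:=k[[x_1,\dots,x_n]]$. Then $$ \mathrm{Ann}(F)=\mathrm{Ann}(G)S[n]+\mathrm{Ann}(H)S[n]+\big(\sigma_G-\sigma_H,\ x_ix_j\big)_{1\le i\le m,\ m+1\le j\le n}, $$ where $\sigma_G\in k[[x_1,\dots,x_m]]$ and $\sigma_H\in k[[x_{m+1},\dots,x_n]]$ are any series of order $\deg(G)$ and $\deg(H)$ respectively such that $\sigma_G\circ G=\sigma_H\circ H=1$.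
   Context: $k$ is an algebraically closed field of characteristic $0$. The power series ring $k[[x_1,\dots,x_n]]$ acts on the polynomial ring $k[y_1,\dots,y_n]$ by partial differentiation, $x_i$ acting as $\partial/\partial y_i$: $x^{\alpha}\circ y^{\beta}=\alpha!\binom{\beta}{\alpha}y^{\beta-\alpha}$ if $\beta\ge\alpha$ (componentwise) and $0$ otherwise. The same formula gives the action of $k[[x_1,\dots,x_m]]$ on $k[y_1,\dots,y_m]$ and of $k[[x_{m+1},\dots,x_n]]$ on $k[y_{m+1},\dots,y_n]$. The annihilator of a polynomial is the ideal of all power series $g$ (in the indicated ring) whose action on the polynomial gives $0$. The order of a power series is the lowest degree of a monomial appearing in it with nonzero coefficient.
   Formalization: G and H are additionally assumed nonconstant (positive degree); without this the claim fails, e.g. m=1, n=2, G=1, H=y_2, σ_G=1, σ_H=x_2, where σ_G−σ_H is a unit but 1 is not in Ann(F). *)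

theory Defs
  imports
    "HOL-Computational_Algebra.Polynomial"
    "HOL-Algebra.Ideal"
    "HOL-Library.Poly_Mapping"
begin

text \<open>Variables are indexed by natural numbers, and an exponent \<open>\<alpha>\<close> is a finitely supported
  function. The same type of monomials serves the variables \<open>x\<^sub>i\<close> and the variables \<open>y\<^sub>i\<close>.\<close>

type_synonym monom_exp = "nat \<Rightarrow>\<^sub>0 nat"

type_synonym 'a mv_poly = "monom_exp \<Rightarrow>\<^sub>0 'a"

type_synonym 'a mv_series = "monom_exp \<Rightarrow> 'a"

definition mdeg :: "monom_exp \<Rightarrow> nat"
  where "mdeg \<alpha> = (\<Sum>i\<in>Poly_Mapping.keys \<alpha>. Poly_Mapping.lookup \<alpha> i)"

text \<open>The order \<open>\<le>\<close> that the library puts on finitely supported functions is lexicographic,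
  hence the separate componentwise order.\<close>

definition exp_le :: "monom_exp \<Rightarrow> monom_exp \<Rightarrow> bool"
  where "exp_le \<alpha> \<beta> \<longleftrightarrow> (\<forall>i. Poly_Mapping.lookup \<alpha> i \<le> Poly_Mapping.lookup \<beta> i)"

definition mfact :: "monom_exp \<Rightarrow> nat"
  where "mfact \<alpha> = (\<Prod>i\<in>Poly_Mapping.keys \<alpha>. fact (Poly_Mapping.lookup \<alpha> i))"

definition mbinom :: "monom_exp \<Rightarrow> monom_exp \<Rightarrow> nat"
  where "mbinom \<beta> \<alpha> = (\<Prod>i\<in>Poly_Mapping.keys \<alpha>. Poly_Mapping.lookup \<beta> i choose Poly_Mapping.lookup \<alpha> i)"


definition polys :: "nat set \<Rightarrow> 'a::zero mv_poly set"
  where "polys V = {F. \<forall>\<beta>\<in>Poly_Mapping.keys F. Poly_Mapping.keys \<beta> \<subseteq> V}"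

text \<open>The value at the zero polynomial is \<open>0\<close> by convention.\<close>

definition poly_deg :: "'a::zero mv_poly \<Rightarrow> nat"
  where "poly_deg F = Max (insert 0 (mdeg ` Poly_Mapping.keys F))"


text \<open>\<open>ps_ring V\<close> is the ring of formal power series in the variables with index in \<open>V\<close>;
  a series is the family of its coefficients, and these vanish at all exponents involving
  a variable outside \<open>V\<close>. In this way \<open>ps_ring V\<close> is a subring of \<open>ps_ring W\<close> when
  \<open>V \<subseteq> W\<close>.\<close>

definition ps_mult :: "'a::comm_ring_1 mv_series \<Rightarrow> 'a mv_series \<Rightarrow> 'a mv_series"
  where "ps_mult f g = (\<lambda>\<alpha>. \<Sum>(\<beta>, \<gamma>) | \<beta> + \<gamma> = \<alpha>. f \<beta> * g \<gamma>)"

definition ps_ring :: "nat set \<Rightarrow> 'a::comm_ring_1 mv_series ring"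
  where "ps_ring V =
    \<lparr>carrier = {f. \<forall>\<alpha>. f \<alpha> \<noteq> 0 \<longrightarrow> Poly_Mapping.keys \<alpha> \<subseteq> V},
     monoid.mult = ps_mult,
     one = (\<lambda>\<alpha>. if \<alpha> = 0 then 1 else 0),
     zero = (\<lambda>_. 0),
     add = (\<lambda>f g \<alpha>. f \<alpha> + g \<alpha>)\<rparr>"

definition ps_var :: "nat \<Rightarrow> 'a::comm_ring_1 mv_series"
  where "ps_var i = (\<lambda>\<alpha>. if \<alpha> = Poly_Mapping.single i 1 then 1 else 0)"

text \<open>Only meaningful for nonzero series.\<close>

definition ps_order :: "'a::zero mv_series \<Rightarrow> nat"
  where "ps_order f = (LEAST d. \<exists>\<alpha>. f \<alpha> \<noteq> 0 \<and> mdeg \<alpha> = d)"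


definition mon_act :: "monom_exp \<Rightarrow> monom_exp \<Rightarrow> 'a::comm_ring_1 mv_poly"
  where "mon_act \<alpha> \<beta> =
    (if exp_le \<alpha> \<beta> then Poly_Mapping.single (\<beta> - \<alpha>) (of_nat (mfact \<alpha> * mbinom \<beta> \<alpha>)) else 0)"

text \<open>The action extends \<^const>\<open>mon_act\<close> linearly in the polynomial and by (possibly infinite) linear
  combinations in the series; on a given monomial \<open>y\<^sup>\<beta>\<close> only the finitely many \<open>x\<^sup>\<alpha>\<close> with
  \<open>\<alpha> \<le> \<beta>\<close> contribute. The factor \<^term>\<open>Poly_Mapping.single 0 c\<close> is the constant polynomial \<open>c\<close>.\<close>

definition ps_act :: "'a::comm_ring_1 mv_series \<Rightarrow> 'a mv_poly \<Rightarrow> 'a mv_poly"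
  where "ps_act g F =
    (\<Sum>\<beta>\<in>Poly_Mapping.keys F. \<Sum>\<alpha> | exp_le \<alpha> \<beta>. Poly_Mapping.single 0 (g \<alpha> * Poly_Mapping.lookup F \<beta>) * mon_act \<alpha> \<beta>)"

definition Ann :: "nat set \<Rightarrow> 'a::comm_ring_1 mv_poly \<Rightarrow> 'a mv_series set"
  where "Ann V F = {g \<in> carrier (ps_ring V). ps_act g F = 0}"


lemma exp_le_add: "\<beta> + \<gamma> = \<alpha> \<Longrightarrow> exp_le \<beta> \<alpha> \<and> exp_le \<gamma> \<alpha>"
  by (auto simp: exp_le_def lookup_add)

lemma finite_exp_le: "finite {\<alpha>. exp_le \<alpha> \<beta>}"
proof (rule finite_imageD)
  define N where "N = Max (insert 0 (Poly_Mapping.lookup \<beta> ` Poly_Mapping.keys \<beta>))"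
  let ?A = "{f. \<forall>i. (i \<in> Poly_Mapping.keys \<beta> \<longrightarrow> f i \<in> {..N}) \<and>
    (i \<notin> Poly_Mapping.keys \<beta> \<longrightarrow> f i = 0)}"
  show "finite (Poly_Mapping.lookup ` {\<alpha>. exp_le \<alpha> \<beta>})"
  proof (rule finite_subset)
    show "Poly_Mapping.lookup ` {\<alpha>. exp_le \<alpha> \<beta>} \<subseteq> ?A"
    proof (rule image_subsetI, rule CollectI, intro allI conjI impI)
      fix \<alpha> i assume "\<alpha> \<in> {\<alpha>. exp_le \<alpha> \<beta>}"
      then have le: "Poly_Mapping.lookup \<alpha> i \<le> Poly_Mapping.lookup \<beta> i"
        by (simp add: exp_le_def)
      show "Poly_Mapping.lookup \<alpha> i \<in> {..N}" if "i \<in> Poly_Mapping.keys \<beta>"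
      proof -
        have "Poly_Mapping.lookup \<beta> i \<le> N"
          unfolding N_def using that by (intro Max_ge) simp_all
        then show ?thesis using le by simp
      qed
      show "Poly_Mapping.lookup \<alpha> i = 0" if "i \<notin> Poly_Mapping.keys \<beta>"
        using le that by (simp add: in_keys_iff)
    qed
    show "finite ?A"
      by (rule finite_set_of_finite_funs) simp_all
  qed
  show "inj_on Poly_Mapping.lookup {\<alpha>. exp_le \<alpha> \<beta>}"
    by (rule inj_onI) (rule poly_mapping_eq_iff[THEN iffD2])
qed

lemma finite_exp_splits: "finite {(\<beta>, \<gamma>). \<beta> + \<gamma> = (\<alpha>::monom_exp)}"
proof (rule finite_subset)
  show "{(\<beta>, \<gamma>). \<beta> + \<gamma> = \<alpha>} \<subseteq> {\<beta>. exp_le \<beta> \<alpha>} \<times> {\<gamma>. exp_le \<gamma> \<alpha>}"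
    using exp_le_add by blast
qed (simp add: finite_exp_le)

lemma keys_add_exp: "Poly_Mapping.keys (\<beta> + \<gamma> :: monom_exp) = Poly_Mapping.keys \<beta> \<union> Poly_Mapping.keys \<gamma>"
  by (auto simp: in_keys_iff lookup_add)

lemma ps_mult_comm: "ps_mult f g = ps_mult g f"
  unfolding ps_mult_def
  by (rule ext, rule sum.reindex_bij_witness[of _ prod.swap prod.swap])
     (auto simp: add.commute mult.commute)

lemma ps_mult_assoc: "ps_mult (ps_mult f g) h = ps_mult f (ps_mult g h)"
proof
  fix \<alpha> :: monom_exp
  let ?D = "\<lambda>\<alpha>. {(\<beta>, \<gamma>). \<beta> + \<gamma> = (\<alpha>::monom_exp)}"
  have "ps_mult (ps_mult f g) h \<alpha> =
      (\<Sum>p\<in>?D \<alpha>. \<Sum>q\<in>?D (fst p). f (fst q) * g (snd q) * h (snd p))"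
    by (simp add: ps_mult_def case_prod_unfold sum_distrib_right)
  also have "\<dots> = (\<Sum>(p, q)\<in>Sigma (?D \<alpha>) (\<lambda>p. ?D (fst p)). f (fst q) * g (snd q) * h (snd p))"
    by (rule sum.Sigma) (use finite_exp_splits in auto)
  also have "\<dots> = (\<Sum>(p, q)\<in>Sigma (?D \<alpha>) (\<lambda>p. ?D (snd p)). f (fst p) * (g (fst q) * h (snd q)))"
    by (rule sum.reindex_bij_witness[of _
          "\<lambda>(p, q). ((fst p + fst q, snd q), (fst p, fst q))"
          "\<lambda>(p, q). ((fst q, snd q + snd p), (snd q, snd p))"])
       (auto simp: add.assoc mult.assoc)
  also have "\<dots> = (\<Sum>p\<in>?D \<alpha>. \<Sum>q\<in>?D (snd p). f (fst p) * (g (fst q) * h (snd q)))"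
    by (rule sum.Sigma[symmetric]) (use finite_exp_splits in auto)
  also have "\<dots> = ps_mult f (ps_mult g h) \<alpha>"
    by (simp add: ps_mult_def case_prod_unfold sum_distrib_left)
  finally show "ps_mult (ps_mult f g) h \<alpha> = ps_mult f (ps_mult g h) \<alpha>" .
qed

lemma ps_mult_one: "ps_mult (\<lambda>\<alpha>. if \<alpha> = 0 then 1 else 0) f = f"
proof
  fix \<alpha>
  have "ps_mult (\<lambda>\<alpha>. if \<alpha> = 0 then 1 else 0) f \<alpha> = (\<Sum>(\<beta>, \<gamma>)\<in>{(0::monom_exp, \<alpha>)}. f \<gamma>)"
    unfolding ps_mult_def
    by (intro sum.mono_neutral_cong_right finite_exp_splits) (auto split: if_splits)
  then show "ps_mult (\<lambda>\<alpha>. if \<alpha> = 0 then 1 else 0) f \<alpha> = f \<alpha>" by simp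
qed

lemma ps_mult_distrib:
  "ps_mult (\<lambda>\<alpha>. f \<alpha> + g \<alpha>) h = (\<lambda>\<alpha>. ps_mult f h \<alpha> + ps_mult g h \<alpha>)"
  by (simp add: ps_mult_def case_prod_unfold distrib_right sum.distrib)

lemma ps_mult_closed:
  assumes "f \<in> carrier (ps_ring V)" "g \<in> carrier (ps_ring V)"
  shows "ps_mult f g \<in> carrier (ps_ring V)"
proof -
  have "Poly_Mapping.keys \<alpha> \<subseteq> V" if "ps_mult f g \<alpha> \<noteq> 0" for \<alpha>
  proof -
    from that obtain p where "p \<in> {(\<beta>, \<gamma>). \<beta> + \<gamma> = \<alpha>}"
      "(case p of (\<beta>, \<gamma>) \<Rightarrow> f \<beta> * g \<gamma>) \<noteq> 0"
      unfolding ps_mult_def by (rule sum.not_neutral_contains_not_neutral)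
    then obtain \<beta> \<gamma> where "\<beta> + \<gamma> = \<alpha>" and nz: "f \<beta> * g \<gamma> \<noteq> 0"
      by (cases p) simp
    then have \<alpha>: "Poly_Mapping.keys \<alpha> = Poly_Mapping.keys \<beta> \<union> Poly_Mapping.keys \<gamma>"
      using keys_add_exp by blast
    have "f \<beta> \<noteq> 0" "g \<gamma> \<noteq> 0" using nz by auto
    then have "Poly_Mapping.keys \<beta> \<subseteq> V" "Poly_Mapping.keys \<gamma> \<subseteq> V"
      using assms by (simp_all add: ps_ring_def)
    then show ?thesis by (simp add: \<alpha>)
  qed
  then show ?thesis by (simp add: ps_ring_def)
qed

lemma cring_ps_ring: "cring (ps_ring V :: 'a::comm_ring_1 mv_series ring)"
proof (rule cringI)
  show "abelian_group (ps_ring V :: 'a mv_series ring)"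
  proof (rule abelian_groupI)
    fix f :: "'a mv_series" assume f: "f \<in> carrier (ps_ring V)"
    show "\<exists>g\<in>carrier (ps_ring V). g \<oplus>\<^bsub>ps_ring V\<^esub> f = \<zero>\<^bsub>ps_ring V\<^esub>"
      by (rule bexI[of _ "\<lambda>\<alpha>. - f \<alpha>"]) (use f in \<open>auto simp: ps_ring_def\<close>)
  next
    fix f g :: "'a mv_series"
    assume f: "f \<in> carrier (ps_ring V)" and g: "g \<in> carrier (ps_ring V)"
    have "Poly_Mapping.keys \<alpha> \<subseteq> V" if "f \<alpha> + g \<alpha> \<noteq> 0" for \<alpha>
      using that f g by (cases "f \<alpha> = 0") (auto simp: ps_ring_def)
    then show "f \<oplus>\<^bsub>ps_ring V\<^esub> g \<in> carrier (ps_ring V)"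
      by (simp add: ps_ring_def)
  qed (auto simp: ps_ring_def algebra_simps)
  show "comm_monoid (ps_ring V :: 'a mv_series ring)"
  proof (rule comm_monoidI)
    fix f g :: "'a mv_series"
    assume "f \<in> carrier (ps_ring V)" "g \<in> carrier (ps_ring V)"
    then show "f \<otimes>\<^bsub>ps_ring V\<^esub> g \<in> carrier (ps_ring V)"
      using ps_mult_closed by (simp add: ps_ring_def)
    show "f \<otimes>\<^bsub>ps_ring V\<^esub> g = g \<otimes>\<^bsub>ps_ring V\<^esub> f"
      by (simp add: ps_ring_def ps_mult_comm)
  qed (simp_all add: ps_ring_def ps_mult_assoc ps_mult_one)
qed (simp add: ps_ring_def ps_mult_distrib)

lemma ps_act_monomial:
  "ps_act (\<lambda>\<gamma>. if \<gamma> = \<alpha> then 1 else 0) (Poly_Mapping.single \<beta> (1::'a::comm_ring_1)) = mon_act \<alpha> \<beta>"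
proof -
  have "ps_act (\<lambda>\<gamma>. if \<gamma> = \<alpha> then 1 else 0) (Poly_Mapping.single \<beta> (1::'a)) =
      (\<Sum>\<gamma> | exp_le \<gamma> \<beta>. if \<gamma> = \<alpha> then mon_act \<gamma> \<beta> else 0)"
    by (auto simp: ps_act_def intro!: sum.cong)
  then show ?thesis
    by (simp add: finite_exp_le mon_act_def)
qed

end

theory Submission
  imports Defs
begin

text \<open>Split \<open>f \<in> Ann(F)\<close> into its restrictions \<open>u\<close>, \<open>v\<close> to the two groups of variables and the
  mixed monomials. Mixed monomials kill \<open>F\<close>, so \<open>u \<circ> G = - v \<circ> H\<close>; the two sides have no variable in
  common, so both are a constant \<open>c\<close>. Comparing coefficients at a monomial of \<open>G\<close> of top degree gives
  \<open>f\<^sub>0 = 0\<close>, and then \<open>f - c (\<sigma>\<^sub>G - \<sigma>\<^sub>H)\<close> is the sum of \<open>u - c \<sigma>\<^sub>G \<in> Ann(G)\<close>, \<open>v + c \<sigma>\<^sub>H \<in> Ann(H)\<close>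
  and the mixed part, which lies in the ideal of the \<open>x\<^sub>i x\<^sub>j\<close>.
  Conversely, series without constant term kill polynomials in the other variables, and
  the elements of \<open>Ann(G)\<close>, \<open>Ann(H)\<close> have no constant term, again by comparison in top degree.\<close>

section \<open>Exponents\<close>

lemma exp_le_refl: "exp_le \<alpha> \<alpha>"
  by (simp add: exp_le_def)

lemma exp_le_trans: "exp_le \<alpha> \<beta> \<Longrightarrow> exp_le \<beta> \<gamma> \<Longrightarrow> exp_le \<alpha> \<gamma>"
  unfolding exp_le_def using le_trans by blast

lemma exp_le_diff: "exp_le (\<beta> - \<alpha>) \<beta>"
  by (simp add: exp_le_def lookup_minus)

lemma exp_le_add_diff: "exp_le \<alpha> \<beta> \<Longrightarrow> \<alpha> + (\<beta> - \<alpha>) = \<beta>"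
  by (rule poly_mapping_eqI) (simp add: exp_le_def lookup_add lookup_minus)

lemma exp_le_iff_add: "exp_le \<alpha> \<beta> \<longleftrightarrow> (\<exists>\<gamma>. \<beta> = \<alpha> + \<gamma>)"
  using exp_le_add_diff[of \<alpha> \<beta>] by (metis exp_le_add)

lemma keys_exp_mono: "exp_le \<alpha> \<beta> \<Longrightarrow> Poly_Mapping.keys \<alpha> \<subseteq> Poly_Mapping.keys \<beta>"
  by (auto simp: exp_le_iff_add keys_add_exp)

text \<open>On the exponents below \<beta> the map \<alpha> \<mapsto> \<beta> - \<alpha> is an
  involution, although subtraction is truncated in general. Hence a single x^\<alpha> carries
  y^\<beta> to a given y^\<delta>.\<close>

lemma exp_diff_eq_iff:
  assumes "exp_le \<alpha> \<beta>"
  shows "\<beta> - \<alpha> = \<delta> \<longleftrightarrow> exp_le \<delta> \<beta> \<and> \<alpha> = \<beta> - \<delta>"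
  using assms exp_le_add_diff by (metis add_diff_cancel_left' add_diff_cancel_right' exp_le_diff)

lemma mdeg_eq_sum:
  assumes "finite A" "Poly_Mapping.keys \<alpha> \<subseteq> A"
  shows "mdeg \<alpha> = (\<Sum>i\<in>A. Poly_Mapping.lookup \<alpha> i)"
  unfolding mdeg_def by (rule sum.mono_neutral_left) (use assms in \<open>auto simp: in_keys_iff\<close>)

lemma mdeg_add: "mdeg (\<alpha> + \<beta>) = mdeg \<alpha> + mdeg \<beta>"
  using mdeg_eq_sum[of "Poly_Mapping.keys (\<alpha> + \<beta>)" \<alpha>] mdeg_eq_sum[of "Poly_Mapping.keys (\<alpha> + \<beta>)" \<beta>]
  by (simp add: mdeg_def[of "\<alpha> + \<beta>"] keys_add_exp lookup_add sum.distrib)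

lemma mdeg_eq_0_iff: "mdeg \<alpha> = 0 \<longleftrightarrow> \<alpha> = 0"
  by (auto simp: mdeg_def in_keys_iff intro!: poly_mapping_eqI)

section \<open>The action of series on polynomials\<close>

text \<open>For \<alpha> below \<beta> this is the product of falling factorials \<beta>! / (\<beta>
  - \<alpha>)!, the number produced by differentiating y^\<beta>.\<close>

definition act_coeff :: "monom_exp \<Rightarrow> monom_exp \<Rightarrow> nat"
  where "act_coeff \<alpha> \<beta> = mfact \<alpha> * mbinom \<beta> \<alpha>"

lemma act_coeff_0: "act_coeff 0 \<beta> = 1"
  by (simp add: act_coeff_def mfact_def mbinom_def)

lemma mfact_pos: "mfact \<alpha> > 0"
  unfolding mfact_def by (rule prod_pos) simp

lemma mfact_eq_prod:
  assumes "finite A" "Poly_Mapping.keys \<alpha> \<subseteq> A"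
  shows "mfact \<alpha> = (\<Prod>i\<in>A. fact (Poly_Mapping.lookup \<alpha> i))"
  unfolding mfact_def by (rule prod.mono_neutral_left) (use assms in \<open>auto simp: in_keys_iff\<close>)

lemma mbinom_eq_prod:
  assumes "finite A" "Poly_Mapping.keys \<alpha> \<subseteq> A"
  shows "mbinom \<beta> \<alpha> = (\<Prod>i\<in>A. Poly_Mapping.lookup \<beta> i choose Poly_Mapping.lookup \<alpha> i)"
  unfolding mbinom_def by (rule prod.mono_neutral_left) (use assms in \<open>auto simp: in_keys_iff\<close>)

lemma act_coeff_mfact:
  assumes "exp_le \<alpha> \<beta>"
  shows "act_coeff \<alpha> \<beta> * mfact (\<beta> - \<alpha>) = mfact \<beta>"
proof -
  let ?A = "Poly_Mapping.keys \<beta>"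
  have sub: "Poly_Mapping.keys \<alpha> \<subseteq> ?A" "Poly_Mapping.keys (\<beta> - \<alpha>) \<subseteq> ?A"
    using assms keys_exp_mono exp_le_diff by blast+
  have "fact (Poly_Mapping.lookup \<alpha> i) * (Poly_Mapping.lookup \<beta> i choose Poly_Mapping.lookup \<alpha> i)
      * fact (Poly_Mapping.lookup (\<beta> - \<alpha>) i) = (fact (Poly_Mapping.lookup \<beta> i) :: nat)" for i
    using binomial_fact_lemma[of "Poly_Mapping.lookup \<alpha> i" "Poly_Mapping.lookup \<beta> i"] assms
    by (simp add: exp_le_def lookup_minus ac_simps)
  then show ?thesis
    unfolding act_coeff_def mfact_eq_prod[OF finite_keys sub(1)] mfact_eq_prod[OF finite_keys sub(2)]
      mbinom_eq_prod[OF finite_keys sub(1)] mfact_def[of \<beta>] prod.distrib[symmetric] by simp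
qed

text \<open>The quotients telescope: (\<beta>!/\<gamma>!) (\<gamma>!/\<delta>!) =
  \<beta>!/\<delta>!. This is the numerical reason why the action respects products of
  series.\<close>

lemma act_coeff_comp:
  assumes "exp_le \<delta> \<gamma>" "exp_le \<gamma> \<beta>"
  shows "act_coeff (\<beta> - \<gamma>) \<beta> * act_coeff (\<gamma> - \<delta>) \<gamma> = act_coeff (\<beta> - \<delta>) \<beta>"
proof -
  \<comment> \<open>\<open>act_coeff_mfact\<close> for the lower exponent \<epsilon> - \<zeta>,
    whose complement in \<epsilon> is \<zeta> again.\<close>
  have *: "act_coeff (\<epsilon> - \<zeta>) \<epsilon> * mfact \<zeta> = mfact \<epsilon>" if "exp_le \<zeta> \<epsilon>" for \<epsilon> \<zeta>
    using act_coeff_mfact[OF exp_le_diff, of \<epsilon> \<zeta>] exp_diff_eq_iff[OF exp_le_diff, of \<epsilon> \<zeta> \<zeta>] that by simp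
  have "act_coeff (\<beta> - \<gamma>) \<beta> * act_coeff (\<gamma> - \<delta>) \<gamma> * mfact \<delta> = act_coeff (\<beta> - \<delta>) \<beta> * mfact \<delta>"
    using *[OF assms(1)] *[OF assms(2)] *[OF exp_le_trans[OF assms]] by (simp add: mult.assoc)
  then show ?thesis using mfact_pos[of \<delta>] by simp
qed

text \<open>From y^\<beta> only \<alpha> = \<beta> - \<delta> reaches y^\<delta>, so the inner sum
  collapses. The index set \<open>A\<close> may exceed the support of \<open>F\<close>, which allows
  several polynomials to be summed over one common set.\<close>

lemma lookup_ps_act:
  assumes "finite A" "Poly_Mapping.keys F \<subseteq> A"
  shows "Poly_Mapping.lookup (ps_act g F) \<delta> =
    (\<Sum>\<beta>\<in>A. if exp_le \<delta> \<beta>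
      then g (\<beta> - \<delta>) * Poly_Mapping.lookup F \<beta> * of_nat (act_coeff (\<beta> - \<delta>) \<beta>) else 0)"
proof -
  have inner: "(\<Sum>\<alpha> | exp_le \<alpha> \<beta>. Poly_Mapping.lookup
        (Poly_Mapping.single 0 (g \<alpha> * Poly_Mapping.lookup F \<beta>) * mon_act \<alpha> \<beta>) \<delta>) =
      (if exp_le \<delta> \<beta> then g (\<beta> - \<delta>) * Poly_Mapping.lookup F \<beta> * of_nat (act_coeff (\<beta> - \<delta>) \<beta>) else 0)"
    (is "?L = ?R") for \<beta>
  proof -
    have "?L = (\<Sum>\<alpha> | exp_le \<alpha> \<beta>. if \<alpha> = \<beta> - \<delta> then ?R else 0)"
      by (rule sum.cong)
        (use exp_diff_eq_iff in \<open>auto simp: mon_act_def mult_single lookup_single act_coeff_def when_def\<close>)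
    then show ?thesis by (simp add: finite_exp_le exp_le_diff)
  qed
  show ?thesis
    unfolding ps_act_def lookup_sum inner
    by (rule sum.mono_neutral_left) (use assms in \<open>auto simp: in_keys_iff\<close>)
qed

lemma ps_act_cong:
  assumes "\<And>\<alpha> \<beta>. \<beta> \<in> Poly_Mapping.keys F \<Longrightarrow> exp_le \<alpha> \<beta> \<Longrightarrow> f \<alpha> = g \<alpha>"
  shows "ps_act f F = ps_act g F"
  unfolding ps_act_def by (intro sum.cong refl) (use assms in auto)

section \<open>Linearity and multiplicativity of the action\<close>

lemma ps_act_add_left: "ps_act (\<lambda>\<alpha>. f \<alpha> + g \<alpha>) F = ps_act f F + ps_act g F"
  by (rule poly_mapping_eqI)
    (auto simp: lookup_ps_act[OF finite_keys order_refl] lookup_add sum.distrib[symmetric]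
      algebra_simps intro!: sum.cong)

lemma lookup_ps_act_scale:
  "Poly_Mapping.lookup (ps_act (\<lambda>\<alpha>. c * f \<alpha>) F) \<delta> = c * Poly_Mapping.lookup (ps_act f F) \<delta>"
  by (auto simp: lookup_ps_act[OF finite_keys order_refl] sum_distrib_left algebra_simps intro!: sum.cong)

lemma ps_act_add_right: "ps_act f (F + G) = ps_act f F + ps_act f G"
proof (rule poly_mapping_eqI)
  fix \<delta>
  let ?A = "Poly_Mapping.keys F \<union> Poly_Mapping.keys G"
  have A: "finite ?A" "Poly_Mapping.keys F \<subseteq> ?A" "Poly_Mapping.keys G \<subseteq> ?A"
    "Poly_Mapping.keys (F + G) \<subseteq> ?A"
    by (simp_all add: Poly_Mapping.keys_add)
  show "Poly_Mapping.lookup (ps_act f (F + G)) \<delta> = Poly_Mapping.lookup (ps_act f F + ps_act f G) \<delta>"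
    unfolding lookup_add lookup_ps_act[OF A(1,2)] lookup_ps_act[OF A(1,3)] lookup_ps_act[OF A(1,4)]
      sum.distrib[symmetric]
    by (intro sum.cong refl) (simp add: algebra_simps)
qed

lemma keys_ps_act:
  assumes "\<delta> \<in> Poly_Mapping.keys (ps_act g F)"
  shows "\<exists>\<beta>\<in>Poly_Mapping.keys F. exp_le \<delta> \<beta>"
proof (rule ccontr)
  assume "\<not> ?thesis"
  then have "Poly_Mapping.lookup (ps_act g F) \<delta> = 0"
    unfolding lookup_ps_act[OF finite_keys order_refl] by (intro sum.neutral) auto
  then show False using assms by (simp add: in_keys_iff)
qed

text \<open>A splitting \<mu> + \<nu> = \<beta> - \<delta> is the same as an intermediate exponent
  \<gamma> = \<delta> + \<mu> between \<delta> and \<beta>. In this form the Cauchy product matches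
  the double sum that arises when two series act in succession.\<close>

lemma ps_mult_diff:
  assumes "exp_le \<delta> \<beta>"
  shows "ps_mult f g (\<beta> - \<delta>) = (\<Sum>\<gamma> | exp_le \<delta> \<gamma> \<and> exp_le \<gamma> \<beta>. f (\<gamma> - \<delta>) * g (\<beta> - \<gamma>))"
  unfolding ps_mult_def
proof (rule sum.reindex_bij_witness[of _ "\<lambda>\<gamma>. (\<gamma> - \<delta>, \<beta> - \<gamma>)" "\<lambda>(\<mu>, \<nu>). \<delta> + \<mu>"])
  fix p assume p: "p \<in> {(\<mu>, \<nu>). \<mu> + \<nu> = \<beta> - \<delta>}"
  obtain \<mu> \<nu> where [simp]: "p = (\<mu>, \<nu>)" by fastforce
  have \<beta>: "\<beta> = \<delta> + \<mu> + \<nu>" using p exp_le_add_diff[OF assms] by (simp add: add.assoc)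
  show "(case p of (\<mu>, \<nu>) \<Rightarrow> \<delta> + \<mu>) \<in> {\<gamma>. exp_le \<delta> \<gamma> \<and> exp_le \<gamma> \<beta>}"
    using \<beta> exp_le_iff_add by auto
  show "((case p of (\<mu>, \<nu>) \<Rightarrow> \<delta> + \<mu>) - \<delta>, \<beta> - (case p of (\<mu>, \<nu>) \<Rightarrow> \<delta> + \<mu>)) = p"
    using \<beta> by simp
  then show "f ((case p of (\<mu>, \<nu>) \<Rightarrow> \<delta> + \<mu>) - \<delta>) * g (\<beta> - (case p of (\<mu>, \<nu>) \<Rightarrow> \<delta> + \<mu>)) =
      (case p of (\<mu>, \<nu>) \<Rightarrow> f \<mu> * g \<nu>)"
    by simp
next
  fix \<gamma> assume "\<gamma> \<in> {\<gamma>. exp_le \<delta> \<gamma> \<and> exp_le \<gamma> \<beta>}"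
  then obtain \<mu> \<nu> where "\<gamma> = \<delta> + \<mu>" "\<beta> = \<delta> + \<mu> + \<nu>" using exp_le_iff_add by auto
  moreover from this have "\<beta> - \<delta> = \<mu> + \<nu>" by (simp add: add.assoc)
  ultimately show "(case (\<gamma> - \<delta>, \<beta> - \<gamma>) of (\<mu>, \<nu>) \<Rightarrow> \<delta> + \<mu>) = \<gamma>"
    "(\<gamma> - \<delta>, \<beta> - \<gamma>) \<in> {(\<mu>, \<nu>). \<mu> + \<nu> = \<beta> - \<delta>}"
    by simp_all
qed

text \<open>Both sides expand to one sum over the chains \<delta> \<le> \<gamma> \<le> \<beta>
  (componentwise), where \<gamma> is the exponent reached after \<open>g\<close> has acted; the
  numerical factors agree by \<open>act_coeff_comp\<close>.\<close>

lemma ps_act_mult: "ps_act (ps_mult f g) F = ps_act f (ps_act g F)"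
proof (rule poly_mapping_eqI)
  fix \<delta>
  \<comment> \<open>The downward closure of the support of \<open>F\<close>: finite, and containing
    the supports of both \<open>F\<close> and \<open>ps_act g F\<close>, so that the two summations
    can be swapped.\<close>
  define A where "A = (\<Union>\<beta>\<in>Poly_Mapping.keys F. {\<alpha>. exp_le \<alpha> \<beta>})"
  have fin: "finite A" by (simp add: A_def finite_exp_le)
  have F: "Poly_Mapping.keys F \<subseteq> A" using exp_le_refl by (auto simp: A_def)
  have gF: "Poly_Mapping.keys (ps_act g F) \<subseteq> A" using keys_ps_act by (fastforce simp: A_def)
  have down: "\<gamma> \<in> A" if "exp_le \<gamma> \<beta>" "\<beta> \<in> A" for \<gamma> \<beta>
    using that exp_le_trans by (auto simp: A_def)
  let ?t = "\<lambda>\<gamma> \<beta>. if exp_le \<delta> \<gamma> \<and> exp_le \<gamma> \<beta> then f (\<gamma> - \<delta>) * g (\<beta> - \<gamma>) * Poly_Mapping.lookup F \<beta>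
    * of_nat (act_coeff (\<beta> - \<delta>) \<beta>) else 0"
  have "Poly_Mapping.lookup (ps_act f (ps_act g F)) \<delta> = (\<Sum>\<gamma>\<in>A. \<Sum>\<beta>\<in>A. ?t \<gamma> \<beta>)"
    unfolding lookup_ps_act[OF fin gF] lookup_ps_act[OF fin F]
    by (auto simp: sum_distrib_left sum_distrib_right act_coeff_comp[symmetric] algebra_simps
        intro!: sum.cong)
  also have "\<dots> = (\<Sum>\<beta>\<in>A. \<Sum>\<gamma>\<in>A. ?t \<gamma> \<beta>)" by (rule sum.swap)
  also have "\<dots> = Poly_Mapping.lookup (ps_act (ps_mult f g) F) \<delta>"
    unfolding lookup_ps_act[OF fin F]
  proof (rule sum.cong[OF refl])
    fix \<beta> assume \<beta>: "\<beta> \<in> A"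
    have "(\<Sum>\<gamma>\<in>A. ?t \<gamma> \<beta>) = (\<Sum>\<gamma> | exp_le \<delta> \<gamma> \<and> exp_le \<gamma> \<beta>. ?t \<gamma> \<beta>)"
      by (rule sum.mono_neutral_right) (use fin down[OF _ \<beta>] in auto)
    also have "\<dots> = (if exp_le \<delta> \<beta> then ps_mult f g (\<beta> - \<delta>) * Poly_Mapping.lookup F \<beta>
        * of_nat (act_coeff (\<beta> - \<delta>) \<beta>) else 0)"
    proof (cases "exp_le \<delta> \<beta>")
      case True
      then show ?thesis by (simp add: ps_mult_diff sum_distrib_right)
    next
      case False
      then show ?thesis using exp_le_trans by (auto intro!: sum.neutral)
    qed
    finally show "(\<Sum>\<gamma>\<in>A. ?t \<gamma> \<beta>) = (if exp_le \<delta> \<beta> then ps_mult f g (\<beta> - \<delta>)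
        * Poly_Mapping.lookup F \<beta> * of_nat (act_coeff (\<beta> - \<delta>) \<beta>) else 0)" .
  qed
  finally show "Poly_Mapping.lookup (ps_act (ps_mult f g) F) \<delta>
      = Poly_Mapping.lookup (ps_act f (ps_act g F)) \<delta>" ..
qed

lemma ps_act_zero_right: "ps_act f 0 = 0"
  by (simp add: ps_act_def)

text \<open>An exponent that acts nontrivially on \<open>F\<close> divides a monomial of
  \<open>F\<close>, so it involves only variables from \<open>W\<close>; in \<open>f\<close> it
  involves only variables from \<open>V\<close>. Only the constant term is left, and it is
  zero.\<close>

lemma ps_act_eq_0:
  assumes "f \<in> carrier (ps_ring V)" "f 0 = 0" "F \<in> polys W" "V \<inter> W = {}"
  shows "ps_act f F = 0"
proof -
  have "ps_act f F = ps_act (\<lambda>_. 0) F"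
  proof (rule ps_act_cong)
    fix \<alpha> \<beta> assume "\<beta> \<in> Poly_Mapping.keys F" "exp_le \<alpha> \<beta>"
    then have "Poly_Mapping.keys \<alpha> \<subseteq> W"
      using keys_exp_mono assms(3) by (fastforce simp: polys_def)
    moreover have "Poly_Mapping.keys \<alpha> \<subseteq> V" if "f \<alpha> \<noteq> 0"
      using that assms(1) by (simp add: ps_ring_def)
    ultimately have "Poly_Mapping.keys \<alpha> = {}" if "f \<alpha> \<noteq> 0" using that assms(4) by blast
    then show "f \<alpha> = 0" using assms(2) by (metis keys_eq_empty)
  qed
  then show ?thesis by (simp add: ps_act_def)
qed

section \<open>Comparison of coefficients in top degree\<close>

lemma poly_deg_attained:
  assumes "poly_deg F > 0"
  obtains \<beta> where "\<beta> \<in> Poly_Mapping.keys F" "mdeg \<beta> = poly_deg F" "\<beta> \<noteq> 0"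
proof -
  have "poly_deg F \<in> insert 0 (mdeg ` Poly_Mapping.keys F)"
    unfolding poly_deg_def by (rule Max_in) auto
  with assms obtain \<beta> where \<beta>: "\<beta> \<in> Poly_Mapping.keys F" "mdeg \<beta> = poly_deg F" by auto
  then have "\<beta> \<noteq> 0" using assms mdeg_eq_0_iff[of \<beta>] by linarith
  with \<beta> show ?thesis by (rule that)
qed

lemma mdeg_le_poly_deg: "\<beta> \<in> Poly_Mapping.keys F \<Longrightarrow> mdeg \<beta> \<le> poly_deg F"
  unfolding poly_deg_def by (rule Max_ge) auto

text \<open>Differentiation lowers the degree, so a monomial of top degree can only come from
  itself, through the constant term of \<open>f\<close>.\<close>

lemma lookup_ps_act_top:
  assumes "\<beta> \<in> Poly_Mapping.keys F" "mdeg \<beta> = poly_deg F"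
  shows "Poly_Mapping.lookup (ps_act f F) \<beta> = f 0 * Poly_Mapping.lookup F \<beta>"
proof -
  have top: "\<gamma> = \<beta>" if \<gamma>: "\<gamma> \<in> Poly_Mapping.keys F" "exp_le \<beta> \<gamma>" for \<gamma>
  proof -
    obtain \<delta> where \<delta>: "\<gamma> = \<beta> + \<delta>" using \<gamma>(2) exp_le_iff_add by blast
    then have "mdeg \<delta> = 0" using mdeg_le_poly_deg[OF \<gamma>(1)] assms(2) by (simp add: mdeg_add)
    then show ?thesis using \<delta> by (simp add: mdeg_eq_0_iff)
  qed
  have "Poly_Mapping.lookup (ps_act f F) \<beta> =
      (\<Sum>\<gamma>\<in>Poly_Mapping.keys F. if \<gamma> = \<beta> then f 0 * Poly_Mapping.lookup F \<beta> else 0)"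
    unfolding lookup_ps_act[OF finite_keys order_refl]
    by (rule sum.cong) (use top exp_le_refl in \<open>auto simp: act_coeff_0\<close>)
  then show ?thesis using assms(1) by simp
qed

text \<open>A top monomial of \<open>F\<close> is not constant, so its coefficient in
  \<open>ps_act f F\<close> vanishes. That coefficient is \<open>f 0\<close> times a nonzero
  coefficient of \<open>F\<close>, and there are no zero divisors.\<close>

lemma const_coeff_eq_0:
  fixes F :: "'a::idom mv_poly"
  assumes "poly_deg F > 0" "Poly_Mapping.keys (ps_act f F) \<subseteq> {0}"
  shows "f 0 = 0"
proof -
  obtain \<beta> where \<beta>: "\<beta> \<in> Poly_Mapping.keys F" "mdeg \<beta> = poly_deg F" "\<beta> \<noteq> 0"
    using poly_deg_attained[OF assms(1)] .
  then have "Poly_Mapping.lookup (ps_act f F) \<beta> = 0"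
    using assms(2) by (auto simp: in_keys_iff)
  then show ?thesis using lookup_ps_act_top[OF \<beta>(1,2)] \<beta>(1) by (simp add: in_keys_iff)
qed

lemma const_coeff_eq_0_if_order_pos:
  assumes "ps_order f > 0"
  shows "f 0 = 0"
proof (rule ccontr)
  assume "f 0 \<noteq> 0"
  then have "ps_order f \<le> 0"
    unfolding ps_order_def by (intro Least_le exI[of _ 0]) (simp add: mdeg_eq_0_iff)
  then show False using assms by simp
qed

section \<open>Ideals of the power series ring\<close>

lemma ps_ring_carrier: "f \<in> carrier (ps_ring V) \<longleftrightarrow> (\<forall>\<alpha>. f \<alpha> \<noteq> 0 \<longrightarrow> Poly_Mapping.keys \<alpha> \<subseteq> V)"
  by (simp add: ps_ring_def)

lemma mem_set_add: "x \<in> A <+>\<^bsub>R\<^esub> B \<longleftrightarrow> (\<exists>a\<in>A. \<exists>b\<in>B. x = a \<oplus>\<^bsub>R\<^esub> b)"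
  unfolding set_add_def' by simp

lemma set_addI: "a \<in> A \<Longrightarrow> b \<in> B \<Longrightarrow> a \<oplus>\<^bsub>R\<^esub> b \<in> A <+>\<^bsub>R\<^esub> B"
  by (auto simp: mem_set_add)

lemma ps_ring_mono: "V \<subseteq> W \<Longrightarrow> carrier (ps_ring V) \<subseteq> carrier (ps_ring W)"
  by (simp add: ps_ring_carrier subset_iff)

lemma ps_ring_ops:
  "monoid.mult (ps_ring V) = ps_mult" "add (ps_ring V) = (\<lambda>f g \<alpha>. f \<alpha> + g \<alpha>)"
  "zero (ps_ring V) = (\<lambda>_. 0)"
  by (simp_all add: ps_ring_def)

lemma ps_ring_a_inv:
  assumes "f \<in> carrier (ps_ring V)"
  shows "\<ominus>\<^bsub>ps_ring V\<^esub> f = (\<lambda>\<alpha>. - f \<alpha>)"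
proof -
  interpret cring "ps_ring V :: 'a mv_series ring" by (rule cring_ps_ring)
  show ?thesis
    by (rule minus_equality) (use assms in \<open>auto simp: ps_ring_ops ps_ring_carrier\<close>)
qed

lemma ps_ring_minus:
  assumes "g \<in> carrier (ps_ring V)"
  shows "f \<ominus>\<^bsub>ps_ring V\<^esub> g = (\<lambda>\<alpha>. f \<alpha> - g \<alpha>)"
  using assms by (simp add: a_minus_def ps_ring_a_inv ps_ring_ops)

lemma ps_ring_scale: "f \<in> carrier (ps_ring V) \<Longrightarrow> (\<lambda>\<alpha>. c * f \<alpha>) \<in> carrier (ps_ring V)"
  unfolding ps_ring_carrier using mult_zero_right by metis

lemma ps_ring_add:
  "f \<in> carrier (ps_ring V) \<Longrightarrow> g \<in> carrier (ps_ring V) \<Longrightarrow> (\<lambda>\<alpha>. f \<alpha> + g \<alpha>) \<in> carrier (ps_ring V)"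
  by (auto simp: ps_ring_carrier) (metis add_0 subsetD)

text \<open>Multiplication by a monomial is a shift of the coefficients. The case \<epsilon> = 0
  gives scalars, and the other cases serve the products of variables and division by a
  monomial.\<close>

lemma ps_mult_monomial:
  "ps_mult (\<lambda>\<alpha>. if \<alpha> = \<epsilon> then c else 0) f = (\<lambda>\<alpha>. if exp_le \<epsilon> \<alpha> then c * f (\<alpha> - \<epsilon>) else 0)"
proof
  fix \<alpha>
  have "ps_mult (\<lambda>\<alpha>. if \<alpha> = \<epsilon> then c else 0) f \<alpha> =
      (\<Sum>(\<beta>, \<gamma>)\<in>(if exp_le \<epsilon> \<alpha> then {(\<epsilon>, \<alpha> - \<epsilon>)} else {}). c * f \<gamma>)"
    unfolding ps_mult_def
    by (intro sum.mono_neutral_cong_right finite_exp_splits)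
      (auto simp: exp_le_add_diff exp_le_iff_add split: if_splits)
  then show "ps_mult (\<lambda>\<alpha>. if \<alpha> = \<epsilon> then c else 0) f \<alpha> = (if exp_le \<epsilon> \<alpha> then c * f (\<alpha> - \<epsilon>) else 0)"
    by simp
qed

lemma ps_ring_ideal_scale:
  assumes "ideal I (ps_ring V)" "f \<in> I"
  shows "(\<lambda>\<alpha>. c * f \<alpha>) \<in> I"
proof -
  have "(\<lambda>\<alpha>. if \<alpha> = 0 then c else 0) \<in> carrier (ps_ring V)" by (simp add: ps_ring_carrier)
  from ideal.I_l_closed[OF assms(1,2) this] show ?thesis
    by (simp add: ps_ring_ops ps_mult_monomial exp_le_def)
qed

lemma ideal_Ann: "ideal (Ann V F) (ps_ring V)"
proof (rule idealI)
  show "ring (ps_ring V :: 'a mv_series ring)" using cring_ps_ring cring.axioms(1) by blast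
  interpret cring "ps_ring V :: 'a mv_series ring" by (rule cring_ps_ring)
  have uminus: "ps_act (\<lambda>\<alpha>. - f \<alpha>) F = - ps_act f F" for f
    using lookup_ps_act_scale[of "-1" f F] by (intro poly_mapping_eqI) simp
  have zero: "ps_act (\<lambda>_. 0) F = 0" by (simp add: ps_act_def)
  show "subgroup (Ann V F) (add_monoid (ps_ring V))"
  proof (rule add.subgroupI)
    show "Ann V F \<noteq> {}" using zero by (auto simp: Ann_def ps_ring_carrier intro!: exI[of _ "\<lambda>_. 0"])
    show "\<ominus>\<^bsub>ps_ring V\<^esub> f \<in> Ann V F" if "f \<in> Ann V F" for f
    proof -
      have f: "f \<in> carrier (ps_ring V)" using that by (simp add: Ann_def)
      show ?thesis
        using that a_inv_closed[OF f] ps_ring_a_inv[OF f] by (simp add: Ann_def uminus)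
    qed
  qed (auto simp: Ann_def ps_ring_ops ps_act_add_left intro: ps_ring_add)
  show "g \<otimes>\<^bsub>ps_ring V\<^esub> f \<in> Ann V F" "f \<otimes>\<^bsub>ps_ring V\<^esub> g \<in> Ann V F"
    if "f \<in> Ann V F" "g \<in> carrier (ps_ring V)" for f g
    using that ps_mult_closed ps_mult_comm[of f g]
    by (auto simp: Ann_def ps_ring_ops ps_act_mult ps_act_zero_right)
qed

text \<open>A series has infinitely many terms, so membership cannot be argued term by term. Instead
  the finitely many generators are removed one at a time: the terms divisible by x^\<epsilon> form a
  single multiple of x^\<epsilon>, and the remaining terms are covered by the other
  generators.\<close>

lemma mem_monomial_ideal:
  assumes "ideal I (ps_ring V)" "finite E"
    and "\<And>\<epsilon>. \<epsilon> \<in> E \<Longrightarrow> (\<lambda>\<alpha>. if \<alpha> = \<epsilon> then 1 else 0) \<in> I"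
    and "f \<in> carrier (ps_ring V)"
    and "\<And>\<alpha>. f \<alpha> \<noteq> 0 \<Longrightarrow> \<exists>\<epsilon>\<in>E. exp_le \<epsilon> \<alpha>"
  shows "f \<in> I"
  using assms(2-)
proof (induction E arbitrary: f rule: finite_induct)
  case empty
  interpret ideal I "ps_ring V" by fact
  have "f = \<zero>\<^bsub>ps_ring V\<^esub>" using empty by (auto simp: ps_ring_ops)
  then show ?case by simp
next
  case (insert \<epsilon> E)
  interpret ideal I "ps_ring V" by fact
  \<comment> \<open>\<open>?d\<close> collects the terms divisible by x^\<epsilon>,
    \<open>?q\<close> is the quotient of \<open>?d\<close> by x^\<epsilon>, and \<open>?r\<close> is
    what remains.\<close>
  let ?q = "\<lambda>\<alpha>. f (\<alpha> + \<epsilon>)"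
  let ?d = "\<lambda>\<alpha>. if exp_le \<epsilon> \<alpha> then f \<alpha> else 0"
  let ?r = "\<lambda>\<alpha>. if exp_le \<epsilon> \<alpha> then 0 else f \<alpha>"
  have "?q \<in> carrier (ps_ring V)"
    using insert.prems(2) unfolding ps_ring_carrier by (metis keys_add_exp le_sup_iff)
  then have "(\<lambda>\<alpha>. if \<alpha> = \<epsilon> then 1 else 0) \<otimes>\<^bsub>ps_ring V\<^esub> ?q \<in> I"
    by (intro I_r_closed insert.prems(1)) simp_all
  then have "ps_mult (\<lambda>\<alpha>. if \<alpha> = \<epsilon> then 1 else 0) ?q \<in> I"
    by (simp only: ps_ring_ops)
  also have "ps_mult (\<lambda>\<alpha>. if \<alpha> = \<epsilon> then 1 else 0) ?q = ?d"
    unfolding ps_mult_monomial using exp_le_add_diff[of \<epsilon>] by (auto simp: add.commute)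
  finally have d: "?d \<in> I" .
  have r: "?r \<in> I"
  proof (rule insert.IH)
    show "?r \<in> carrier (ps_ring V)" using insert.prems(2) by (auto simp: ps_ring_carrier)
    show "\<exists>\<epsilon>\<in>E. exp_le \<epsilon> \<alpha>" if "?r \<alpha> \<noteq> 0" for \<alpha>
      using that insert.prems(3)[of \<alpha>] by (auto split: if_splits)
  qed (use insert.prems(1) in auto)
  have "?d \<oplus>\<^bsub>ps_ring V\<^esub> ?r \<in> I" by (rule additive_subgroup.a_closed[OF ideal.axioms(1)[OF assms(1)] d r])
  also have "?d \<oplus>\<^bsub>ps_ring V\<^esub> ?r = f" by (auto simp: ps_ring_ops)
  finally show ?case .
qed

lemma ps_var_mult:
  "ps_mult (ps_var i) (ps_var j) =
    (\<lambda>\<alpha>. if \<alpha> = Poly_Mapping.single i 1 + Poly_Mapping.single j 1 then 1 else 0)"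
  unfolding ps_var_def[of i] ps_mult_monomial
  by (rule ext) (auto simp: ps_var_def exp_le_add_diff exp_le_iff_add)

section \<open>The annihilator of a sum in disjoint variables\<close>

text \<open>Comparison in top degree shows that an annihilator of \<open>G\<close> has no constant
  term, hence it also kills \<open>H\<close>. With the summands exchanged the same lemma serves
  \<open>Ann(H)\<close>.\<close>

lemma Ann_subset_Ann_add:
  fixes G H :: "'a::idom mv_poly"
  assumes "poly_deg G > 0" "H \<in> polys W" "V \<inter> W = {}" "V \<subseteq> U"
  shows "Ann V G \<subseteq> Ann U (G + H)"
proof
  fix f assume f: "f \<in> Ann V G"
  then have "f 0 = 0" using const_coeff_eq_0[OF assms(1), of f] by (simp add: Ann_def)
  then have "ps_act f H = 0" using f assms(2,3) by (intro ps_act_eq_0[of f V]) (auto simp: Ann_def)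
  then show "f \<in> Ann U (G + H)"
    using f ps_ring_mono[OF assms(4)] by (auto simp: Ann_def ps_act_add_right)
qed

lemma ps_var_mult_mem_Ann:
  assumes "G \<in> polys V" "H \<in> polys W" "V \<inter> W = {}" "i \<in> V" "j \<in> W" "V \<subseteq> U" "W \<subseteq> U"
  shows "ps_mult (ps_var i) (ps_var j) \<in> Ann U (G + H)"
proof -
  let ?\<epsilon> = "Poly_Mapping.single i 1 + Poly_Mapping.single j (1::nat)"
  have keys: "Poly_Mapping.keys ?\<epsilon> = {i, j}" by (auto simp: keys_add_exp)
  \<comment> \<open>Applied with \<open>P\<close> = \<open>G\<close>, \<open>X\<close> =
    \<open>V\<close> and with \<open>P\<close> = \<open>H\<close>, \<open>X\<close> =
    \<open>W\<close>: the single exponent of the product always involves a variable outside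
    \<open>X\<close>.\<close>
  have "ps_act (ps_mult (ps_var i) (ps_var j)) P = ps_act (\<lambda>_. 0) P"
    if "P \<in> polys X" "\<not> {i, j} \<subseteq> X" for P :: "'a mv_poly" and X
  proof (rule ps_act_cong)
    fix \<alpha> \<beta> assume "\<beta> \<in> Poly_Mapping.keys P" "exp_le \<alpha> \<beta>"
    then have "Poly_Mapping.keys \<alpha> \<subseteq> X" using keys_exp_mono that(1) by (fastforce simp: polys_def)
    then have "\<alpha> \<noteq> ?\<epsilon>" using keys that(2) by metis
    then show "ps_mult (ps_var i) (ps_var j) \<alpha> = 0" by (simp add: ps_var_mult)
  qed
  moreover have "j \<notin> V" "i \<notin> W" using assms(3-5) by auto
  ultimately have "ps_act (ps_mult (ps_var i) (ps_var j)) (G + H) = ps_act (\<lambda>_. 0) (G + H)"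
    using assms(1,2) by (simp add: ps_act_add_right)
  then have "ps_act (ps_mult (ps_var i) (ps_var j)) (G + H) = 0" by (simp add: ps_act_def[of "\<lambda>_. 0"])
  moreover have "ps_mult (ps_var i) (ps_var j) \<in> carrier (ps_ring U)"
    using keys assms(4-) unfolding ps_ring_carrier ps_var_mult by auto
  ultimately show ?thesis by (simp add: Ann_def)
qed

text \<open>Here \<open>c\<close> is the common constant by which the two pure parts of
  \<open>f\<close> fail to annihilate \<open>G\<close> and \<open>H\<close>, up to sign. Since
  \<open>s\<close> and \<open>t\<close> send \<open>G\<close> and \<open>H\<close> to 1, a multiple
  of \<open>s - t\<close> corrects both failures at once.\<close>

lemma Ann_add_decomp:
  fixes G H :: "'a::idom mv_poly"
  assumes G: "G \<in> polys V" and H: "H \<in> polys W" and disj: "V \<inter> W = {}"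
    and deg: "poly_deg G > 0"
    and sG: "s \<in> carrier (ps_ring V)" "ps_act s G = 1"
    and tH: "t \<in> carrier (ps_ring W)" "ps_act t H = 1"
    and f: "f \<in> Ann U (G + H)"
  obtains a b c r where "a \<in> Ann V G" "b \<in> Ann W H" "r \<in> carrier (ps_ring U)"
    and "\<And>\<alpha>. r \<alpha> \<noteq> 0 \<Longrightarrow> \<not> Poly_Mapping.keys \<alpha> \<subseteq> V \<and> \<not> Poly_Mapping.keys \<alpha> \<subseteq> W"
    and "f = (\<lambda>\<alpha>. a \<alpha> + b \<alpha> + (c * (s \<alpha> - t \<alpha>) + r \<alpha>))"
proof -
  define u where "u = (\<lambda>\<alpha>. if Poly_Mapping.keys \<alpha> \<subseteq> V then f \<alpha> else 0)"
  define v where "v = (\<lambda>\<alpha>. if Poly_Mapping.keys \<alpha> \<subseteq> W then f \<alpha> else 0)"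
  have u: "u \<in> carrier (ps_ring V)" by (simp add: u_def ps_ring_carrier)
  have v: "v \<in> carrier (ps_ring W)" by (simp add: v_def ps_ring_carrier)
  have down: "Poly_Mapping.keys \<alpha> \<subseteq> X"
    if "P \<in> polys X" "\<beta> \<in> Poly_Mapping.keys P" "exp_le \<alpha> \<beta>" for P :: "'a mv_poly" and X \<alpha> \<beta>
    using that keys_exp_mono by (fastforce simp: polys_def)
  have "ps_act f G = ps_act u G" by (rule ps_act_cong) (use down[OF G] in \<open>auto simp: u_def\<close>)
  moreover have "ps_act f H = ps_act v H" by (rule ps_act_cong) (use down[OF H] in \<open>auto simp: v_def\<close>)
  ultimately have sum0: "ps_act u G + ps_act v H = 0"
    using f by (simp add: Ann_def ps_act_add_right)
  then have eq: "ps_act v H = - ps_act u G" by (simp add: eq_neg_iff_add_eq_0 add.commute)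
  \<comment> \<open>\<open>ps_act u G\<close> involves only variables from \<open>V\<close>, but by
    \<open>eq\<close> it has the same support as a polynomial in the variables from
    \<open>W\<close>.\<close>
  have keys_u: "Poly_Mapping.keys (ps_act u G) \<subseteq> {0}"
  proof
    fix \<delta> assume d: "\<delta> \<in> Poly_Mapping.keys (ps_act u G)"
    then have "Poly_Mapping.keys \<delta> \<subseteq> V" using keys_ps_act down[OF G] by blast
    moreover have "\<delta> \<in> Poly_Mapping.keys (ps_act v H)" using d eq by (simp add: in_keys_iff)
    then have "Poly_Mapping.keys \<delta> \<subseteq> W" using keys_ps_act down[OF H] by blast
    ultimately have "Poly_Mapping.keys \<delta> = {}" using disj by blast
    then show "\<delta> \<in> {0}" by (simp add: keys_eq_empty)
  qed
  define c where "c = Poly_Mapping.lookup (ps_act u G) 0"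
  \<comment> \<open>The exponent 0 passes both tests in the definitions of \<open>u\<close> and
    \<open>v\<close>, so a constant term would be counted twice.\<close>
  have f0: "f 0 = 0" using const_coeff_eq_0[OF deg keys_u] by (simp add: u_def)
  have lookup_u: "Poly_Mapping.lookup (ps_act u G) \<delta> = (if \<delta> = 0 then c else 0)" for \<delta>
    using keys_u by (auto simp: c_def in_keys_iff)
  \<comment> \<open>The corrections cancel the constants: \<open>a\<close> sends \<open>G\<close> to
    c - c, and \<open>b\<close> sends \<open>H\<close> to -c + c.\<close>
  define a where "a = (\<lambda>\<alpha>. u \<alpha> + (- c) * s \<alpha>)"
  define b where "b = (\<lambda>\<alpha>. v \<alpha> + c * t \<alpha>)"
  define r where "r = (\<lambda>\<alpha>. f \<alpha> - (u \<alpha> + v \<alpha>))"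
  have "ps_act a G = 0"
    by (rule poly_mapping_eqI, unfold a_def ps_act_add_left lookup_add lookup_ps_act_scale)
      (simp add: sG lookup_u lookup_one when_def)
  moreover have "a \<in> carrier (ps_ring V)"
    unfolding a_def by (intro ps_ring_add ps_ring_scale u sG(1))
  ultimately have "a \<in> Ann V G" by (simp add: Ann_def)
  moreover have "b \<in> Ann W H"
  proof -
    have "ps_act b H = 0"
      by (rule poly_mapping_eqI, unfold b_def ps_act_add_left lookup_add lookup_ps_act_scale)
        (simp add: tH eq lookup_u lookup_one when_def)
    moreover have "b \<in> carrier (ps_ring W)"
      unfolding b_def by (intro ps_ring_add ps_ring_scale v tH(1))
    ultimately show ?thesis by (simp add: Ann_def)
  qed
  moreover have supp: "\<not> Poly_Mapping.keys \<alpha> \<subseteq> V \<and> \<not> Poly_Mapping.keys \<alpha> \<subseteq> W" "f \<alpha> \<noteq> 0"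
    if "r \<alpha> \<noteq> 0" for \<alpha>
  proof -
    \<comment> \<open>At \<alpha> = 0 the value of \<open>r\<close> is \<open>- f 0\<close>, which
      is zero.\<close>
    have "Poly_Mapping.keys \<alpha> \<noteq> {}" using that f0 by (auto simp: r_def u_def v_def)
    then have "\<not> (Poly_Mapping.keys \<alpha> \<subseteq> V \<and> Poly_Mapping.keys \<alpha> \<subseteq> W)" using disj by blast
    then show "\<not> Poly_Mapping.keys \<alpha> \<subseteq> V \<and> \<not> Poly_Mapping.keys \<alpha> \<subseteq> W" "f \<alpha> \<noteq> 0"
      using that by (auto simp: r_def u_def v_def split: if_splits)
  qed
  moreover have "r \<in> carrier (ps_ring U)"
    using f supp(2) by (auto simp: Ann_def ps_ring_carrier)
  moreover have "f = (\<lambda>\<alpha>. a \<alpha> + b \<alpha> + (c * (s \<alpha> - t \<alpha>) + r \<alpha>))"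
    by (simp add: a_def b_def r_def algebra_simps)
  ultimately show ?thesis using that by blast
qed

text \<open>Positive degrees rule out a degenerate case: for G = 1 and H a single variable,
  \<open>\<sigma>\<^sub>G\<close> has constant term 1 and \<open>\<sigma>\<^sub>H\<close> has none,
  so their difference is a unit and would generate the whole ring although F is nonzero.\<close>

theorem lemma3p1:
  fixes m n :: nat
    and G H F :: "'k::{alg_closed_field, field_char_0} mv_poly"
    and \<sigma>\<^sub>G \<sigma>\<^sub>H :: "'k mv_series"
  assumes "m \<le> n"
    and "G \<in> polys {1..m}"
    and "H \<in> polys {m+1..n}"
    and "poly_deg G > 0"
    and "poly_deg H > 0"
    and "F = G + H"
    and "\<sigma>\<^sub>G \<in> carrier (ps_ring {1..m})"
    and "\<sigma>\<^sub>H \<in> carrier (ps_ring {m+1..n})"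
    and "ps_order \<sigma>\<^sub>G = poly_deg G"
    and "ps_order \<sigma>\<^sub>H = poly_deg H"
    and "ps_act \<sigma>\<^sub>G G = 1"
    and "ps_act \<sigma>\<^sub>H H = 1"
  shows "let S = ps_ring {1..n} in Ann {1..n} F =
    Idl\<^bsub>S\<^esub> (Ann {1..m} G) <+>\<^bsub>S\<^esub> Idl\<^bsub>S\<^esub> (Ann {m+1..n} H) <+>\<^bsub>S\<^esub>
    Idl\<^bsub>S\<^esub> ({\<sigma>\<^sub>G \<ominus>\<^bsub>S\<^esub> \<sigma>\<^sub>H} \<union>
      {ps_var i \<otimes>\<^bsub>S\<^esub> ps_var j | i j. 1 \<le> i \<and> i \<le> m \<and> m + 1 \<le> j \<and> j \<le> n})"
proof -
  define S where "S = (ps_ring {1..n} :: 'k mv_series ring)"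
  interpret cring S unfolding S_def by (rule cring_ps_ring)
  have disj: "{1..m} \<inter> {m+1..n} = {}" and sub: "{1..m} \<subseteq> {1..n}" "{m+1..n} \<subseteq> {1..n}"
    using assms(1) by auto
  have Ann: "ideal (Ann {1..n} F) S" unfolding S_def by (rule ideal_Ann)
  then interpret A: ideal "Ann {1..n} F" S .
  let ?M = "{ps_var i \<otimes>\<^bsub>S\<^esub> ps_var j | i j. 1 \<le> i \<and> i \<le> m \<and> m + 1 \<le> j \<and> j \<le> n}"
  let ?T = "{\<sigma>\<^sub>G \<ominus>\<^bsub>S\<^esub> \<sigma>\<^sub>H} \<union> ?M"
  let ?IG = "Idl\<^bsub>S\<^esub> (Ann {1..m} G)" and ?IH = "Idl\<^bsub>S\<^esub> (Ann {m+1..n} H)" and ?IT = "Idl\<^bsub>S\<^esub> ?T"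
  have AG: "Ann {1..m} G \<subseteq> Ann {1..n} F"
    using Ann_subset_Ann_add[OF assms(4,3) disj sub(1)] assms(6) by simp
  have AH: "Ann {m+1..n} H \<subseteq> Ann {1..n} F"
    using Ann_subset_Ann_add[OF assms(5,2) _ sub(2)] disj assms(6) by (simp add: add.commute Int_commute)
  have \<sigma>G: "\<sigma>\<^sub>G \<in> carrier S" and \<sigma>H: "\<sigma>\<^sub>H \<in> carrier S"
    using assms(7,8) ps_ring_mono[OF sub(1)] ps_ring_mono[OF sub(2)] by (auto simp: S_def)
  have diff: "\<sigma>\<^sub>G \<ominus>\<^bsub>S\<^esub> \<sigma>\<^sub>H = (\<lambda>\<alpha>. \<sigma>\<^sub>G \<alpha> - \<sigma>\<^sub>H \<alpha>)"
    using \<sigma>H by (simp add: S_def ps_ring_minus)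
  \<comment> \<open>Positive order means no constant term, so each of the two series kills the
    summand in the other variables.\<close>
  have "ps_act \<sigma>\<^sub>G H = 0"
    using const_coeff_eq_0_if_order_pos[of \<sigma>\<^sub>G] assms(4,9) by (intro ps_act_eq_0[OF assms(7) _ assms(3) disj]) simp
  moreover have "ps_act \<sigma>\<^sub>H G = 0"
    using const_coeff_eq_0_if_order_pos[of \<sigma>\<^sub>H] assms(5,10) disj
    by (intro ps_act_eq_0[OF assms(8) _ assms(2)]) auto
  ultimately have actF: "ps_act \<sigma>\<^sub>G F = 1" "ps_act \<sigma>\<^sub>H F = 1"
    using assms(6,11,12) by (simp_all add: ps_act_add_right)
  \<comment> \<open>Additivity is applied to (\<open>\<sigma>\<^sub>G\<close> -
    \<open>\<sigma>\<^sub>H\<close>) + \<open>\<sigma>\<^sub>H\<close>; as both series send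
    \<open>F\<close> to 1, the difference sends it to 0.\<close>
  have "ps_act (\<lambda>\<alpha>. \<sigma>\<^sub>G \<alpha> - \<sigma>\<^sub>H \<alpha>) F + ps_act \<sigma>\<^sub>H F = ps_act \<sigma>\<^sub>G F"
    by (simp add: ps_act_add_left[symmetric])
  then have "\<sigma>\<^sub>G \<ominus>\<^bsub>S\<^esub> \<sigma>\<^sub>H \<in> Ann {1..n} F"
    using minus_closed[OF \<sigma>G \<sigma>H] actF by (simp add: Ann_def diff) (simp add: S_def)
  moreover have "?M \<subseteq> Ann {1..n} F"
    using ps_var_mult_mem_Ann[OF assms(2,3) disj _ _ sub] assms(6) by (auto simp: S_def ps_ring_ops)
  ultimately have AT: "?T \<subseteq> Ann {1..n} F" by blast
  have carr: "Ann {1..m} G \<subseteq> carrier S" "Ann {m+1..n} H \<subseteq> carrier S" "?T \<subseteq> carrier S"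
    using AG AH AT A.a_subset by blast+
  have IT: "ideal ?IT (ps_ring {1..n})" using genideal_ideal[OF carr(3)] by (simp only: S_def)
  \<comment> \<open>Each generating set lies in the ideal \<open>Ann(F)\<close>, hence so does the
    ideal that it generates.\<close>
  have le: "?IG \<subseteq> Ann {1..n} F" "?IH \<subseteq> Ann {1..n} F" "?IT \<subseteq> Ann {1..n} F"
    using genideal_minimal[OF Ann] AG AH AT by blast+
  have "?IG <+>\<^bsub>S\<^esub> ?IH <+>\<^bsub>S\<^esub> ?IT \<subseteq> Ann {1..n} F"
  proof
    fix f assume "f \<in> ?IG <+>\<^bsub>S\<^esub> ?IH <+>\<^bsub>S\<^esub> ?IT"
    then obtain e t where e: "e \<in> ?IG <+>\<^bsub>S\<^esub> ?IH" and t: "t \<in> ?IT" and f: "f = e \<oplus>\<^bsub>S\<^esub> t"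
      unfolding mem_set_add[of f] by (elim bexE)
    from e obtain g h where g: "g \<in> ?IG" and h: "h \<in> ?IH" and e_eq: "e = g \<oplus>\<^bsub>S\<^esub> h"
      unfolding mem_set_add by (elim bexE)
    show "f \<in> Ann {1..n} F"
      unfolding f e_eq by (intro additive_subgroup.a_closed[OF ideal.axioms(1)[OF Ann]]
          subsetD[OF le(1) g] subsetD[OF le(2) h] subsetD[OF le(3) t])
  qed
  moreover have "Ann {1..n} F \<subseteq> ?IG <+>\<^bsub>S\<^esub> ?IH <+>\<^bsub>S\<^esub> ?IT"
  proof
    fix f assume "f \<in> Ann {1..n} F"
    then have f: "f \<in> Ann {1..n} (G + H)" using assms(6) by simp
    obtain a b c r where a: "a \<in> Ann {1..m} G" and b: "b \<in> Ann {m+1..n} H"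
      and r: "r \<in> carrier (ps_ring {1..n})"
      and supp: "\<And>\<alpha>. r \<alpha> \<noteq> 0 \<Longrightarrow>
        \<not> Poly_Mapping.keys \<alpha> \<subseteq> {1..m} \<and> \<not> Poly_Mapping.keys \<alpha> \<subseteq> {m+1..n}"
      and f_eq: "f = (\<lambda>\<alpha>. a \<alpha> + b \<alpha> + (c * (\<sigma>\<^sub>G \<alpha> - \<sigma>\<^sub>H \<alpha>) + r \<alpha>))"
      by (rule Ann_add_decomp[OF assms(2,3) disj assms(4,7,11,8,12) f]) (rule that)
    have rT: "r \<in> ?IT"
    proof (rule mem_monomial_ideal[of _ "{1..n}"])
      let ?E = "(\<lambda>(i, j). Poly_Mapping.single i 1 + Poly_Mapping.single j (1::nat)) `
        ({1..m} \<times> {m+1..n})"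
      show "ideal ?IT (ps_ring {1..n})" by (rule IT)
      show "finite ?E" by simp
      show "(\<lambda>\<alpha>. if \<alpha> = \<epsilon> then 1 else 0) \<in> ?IT" if "\<epsilon> \<in> ?E" for \<epsilon>
      proof -
        obtain i j where ij: "i \<in> {1..m}" "j \<in> {m+1..n}"
          and \<epsilon>: "\<epsilon> = Poly_Mapping.single i 1 + Poly_Mapping.single j 1"
          using \<open>\<epsilon> \<in> ?E\<close> by auto
        have "ps_mult (ps_var i) (ps_var j) \<in> ?M" using ij by (auto simp: S_def ps_ring_ops)
        then have "ps_mult (ps_var i) (ps_var j) \<in> ?IT" using genideal_self[OF carr(3)] by blast
        then show ?thesis unfolding ps_var_mult \<epsilon> .
      qed
      show "\<exists>\<epsilon>\<in>?E. exp_le \<epsilon> \<alpha>" if "r \<alpha> \<noteq> 0" for \<alpha>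
      proof -
        have keys: "Poly_Mapping.keys \<alpha> \<subseteq> {1..n}" using that r by (simp add: ps_ring_carrier)
        \<comment> \<open>A mixed monomial has a variable outside the second group and one outside
          the first. All its variables have index in \<open>{1..n}\<close>, so these two lie in the
          first and the second group respectively.\<close>
        obtain i where i: "i \<in> Poly_Mapping.keys \<alpha>" "i \<notin> {m+1..n}" using supp[OF \<open>r \<alpha> \<noteq> 0\<close>] by blast
        obtain j where j: "j \<in> Poly_Mapping.keys \<alpha>" "j \<notin> {1..m}" using supp[OF \<open>r \<alpha> \<noteq> 0\<close>] by blast
        have ij: "i \<in> {1..m}" "j \<in> {m+1..n}" using i j keys by auto
        \<comment> \<open>The groups are disjoint, so i \<noteq> j and it suffices that \<alpha> is
          at least 1 at each of the two indices.\<close>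
        have "exp_le (Poly_Mapping.single i 1 + Poly_Mapping.single j 1) \<alpha>"
          using i(1) j(1) ij
          by (auto simp: exp_le_def lookup_add lookup_single when_def in_keys_iff Suc_le_eq)
        then show ?thesis using ij by (intro bexI[OF _ image_eqI[of _ _ "(i, j)"]]) auto
      qed
    qed (fact r)
    have "\<sigma>\<^sub>G \<ominus>\<^bsub>S\<^esub> \<sigma>\<^sub>H \<in> ?IT" using genideal_self[OF carr(3)] by blast
    from ps_ring_ideal_scale[OF IT this]
    have dT: "(\<lambda>\<alpha>. c * (\<sigma>\<^sub>G \<alpha> - \<sigma>\<^sub>H \<alpha>)) \<in> ?IT" unfolding diff .
    have f_sum: "f = a \<oplus>\<^bsub>S\<^esub> b \<oplus>\<^bsub>S\<^esub> ((\<lambda>\<alpha>. c * (\<sigma>\<^sub>G \<alpha> - \<sigma>\<^sub>H \<alpha>)) \<oplus>\<^bsub>S\<^esub> r)"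
      unfolding f_eq S_def ps_ring_ops ..
    show "f \<in> ?IG <+>\<^bsub>S\<^esub> ?IH <+>\<^bsub>S\<^esub> ?IT"
      unfolding f_sum
      by (intro set_addI subsetD[OF genideal_self[OF carr(1)] a] subsetD[OF genideal_self[OF carr(2)] b]
          additive_subgroup.a_closed[OF ideal.axioms(1)[OF genideal_ideal[OF carr(3)]] dT rT])
  qed
  ultimately show ?thesis
    unfolding Let_def S_def[symmetric] by (rule subset_antisym[rotated])
qed

end
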